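(* Consider ordinary factor order on $P^*$ where $P=\{a,b\}$. Then the language $\mathcal{M}(a)=\{w\in P^*:\mu(a,w)\neq0\}$ is not regular, where $\mu$ is the Möbius function of ordinary factor order.
   Context: $P^*$ is the free monoid of finite words over the two-letter alphabet $\{a,b\}$. Ordinary factor order: $u\le w$ iff $w=xuy$ for some words $x,y$. The Möbius function $\mu$ of this poset is the inverse of the zeta function in the incidence algebra: $\mu(u,u)=1$, $\mu(u,w)=-\sum_{u\le v<w}\mu(u,v)$ for $u<w$, and $\mu(u,w)=0$ if $u\not\le w$. A language $\mathcal{L}\subseteq P^*$ is regular if its generating function $\sum_{w\in\mathcal{L}}w$ is rational in the formal power series algebra in noncommuting variables $a,b$ (equivalently, $\mathcal{L}$ is accepted by a nondeterministic finite automaton). *)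

theory Defs
  imports Main "HOL-Library.Sublist"
begin

text \<open>The two-letter alphabet \<open>P = {a, b}\<close>; words over it are lists. The factor order on words is
  \<^const>\<open>sublist\<close> (contiguous sublists), with strict part \<^const>\<open>strict_sublist\<close>.\<close>

datatype letter = Letter_a | Letter_b

lemma finite_factors: "finite {v. sublist v w}"
  by (metis List.finite_set set_sublists_eq)

lemma strict_sublist_length: "strict_sublist v w \<Longrightarrow> length v < length w"
  by (auto simp: strict_sublist_def sublist_def)

text \<open>The interval \<open>u \<le> v < w\<close> is finite by \<open>finite_factors\<close>, so the sum is a genuine finite sum.\<close>

function factor_moebius :: "'a list \<Rightarrow> 'a list \<Rightarrow> int" where
  "factor_moebius u w =
     (if u = w then 1
      else if sublist u w
        then - (\<Sum>v \<in> {v. sublist u v \<and> strict_sublist v w}. factor_moebius u v)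
      else 0)"
  by pat_completeness auto
termination
  by (relation "measure (\<lambda>(u, w). length w)") (auto dest: strict_sublist_length)

declare factor_moebius.simps [simp del]

text \<open>It is the inverse of the zeta function of the factor order.\<close>

lemma sum_factor_moebius:
  "(\<Sum>v \<in> {v. sublist u v \<and> sublist v w}. factor_moebius u v) = (if u = w then 1 else 0)"
proof (cases "sublist u w")
  case True
  let ?I = "{v. sublist u v \<and> strict_sublist v w}"
  have fin: "finite ?I"
    by (rule finite_subset[OF _ finite_factors[of w]]) (auto simp: strict_sublist_def)
  have eq: "{v. sublist u v \<and> sublist v w} = insert w ?I"
    using True by (auto simp: strict_sublist_def)
  have "w \<notin> ?I" by (simp add: strict_sublist_def)
  then have sum_eq: "(\<Sum>v \<in> {v. sublist u v \<and> sublist v w}. factor_moebius u v) =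
      factor_moebius u w + (\<Sum>v \<in> ?I. factor_moebius u v)"
    unfolding eq using fin by simp
  show ?thesis
  proof (cases "u = w")
    case True
    then have "?I = {}"
      using sublist_order.order.antisym by (auto simp: strict_sublist_def)
    then show ?thesis unfolding sum_eq using True factor_moebius.simps[of u w]
      by (simp only: sum.empty if_True) simp
  next
    case False
    then show ?thesis using sum_eq \<open>sublist u w\<close> factor_moebius.simps[of u w] by simp
  qed
next
  case False
  then have "{v. sublist u v \<and> sublist v w} = {}"
    using sublist_order.order.trans by blast
  then show ?thesis using False by (metis sum.empty sublist_order.order.refl)
qed

text \<open>Formal power series in noncommuting variables from \<open>'a\<close> with integer coefficients: the series
  \<open>\<Sum>\<^sub>w f\<^sub>w w\<close> is represented by its coefficient function.\<close>

type_synonym 'a series = "'a list \<Rightarrow> int"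

definition monomial :: "'a list \<Rightarrow> 'a series" where
  "monomial u = (\<lambda>w. if w = u then 1 else 0)"

definition series_mult :: "'a series \<Rightarrow> 'a series \<Rightarrow> 'a series" where
  "series_mult f g = (\<lambda>w. \<Sum>(u, v) \<in> {(u, v). u @ v = w}. f u * g v)"

primrec series_power :: "'a series \<Rightarrow> nat \<Rightarrow> 'a series" where
  "series_power f 0 = monomial []"
| "series_power f (Suc n) = series_mult f (series_power f n)"

text \<open>\<open>f\<^sup>* = \<Sum>\<^sub>n f\<^sup>n\<close>, meaningful only if \<open>f\<close> has constant term 0. In that case \<open>f\<^sup>n\<close> has no words of
  length less than \<open>n\<close> (lemma \<open>series_power_eq_0\<close>), so truncating the sum at \<open>length w\<close> gives the
  coefficient of \<open>w\<close> in the infinite sum.\<close>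

definition series_star :: "'a series \<Rightarrow> 'a series" where
  "series_star f = (\<lambda>w. \<Sum>n \<le> length w. series_power f n w)"

lemma finite_splits: "finite {(u, v). u @ v = w}"
  by (rule finite_subset[of _ "{u. sublist u w} \<times> {v. sublist v w}"])
     (auto simp: finite_factors)

lemma series_power_eq_0:
  assumes "f [] = 0" and "length w < n"
  shows "series_power f n w = 0"
  using assms(2)
proof (induction n arbitrary: w)
  case (Suc n)
  have "f u * series_power f n v = 0" if "u @ v = w" for u v
    using that Suc assms(1) by (cases u) auto
  then show ?case by (auto simp: series_mult_def intro!: sum.neutral)
qed simp

text \<open>Hence \<open>f\<^sup>* = 1 + f f\<^sup>*\<close>, i.e. \<open>f\<^sup>* = (1 - f)\<^sup>-\<^sup>1\<close>.\<close>

lemma series_star_unfold: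
  assumes "f [] = 0"
  shows "series_star f w = monomial [] w + series_mult f (series_star f) w"
proof -
  have star: "series_star f v = (\<Sum>n \<le> N. series_power f n v)" if "length v \<le> N" for v N
    unfolding series_star_def
    using that by (intro sum.mono_neutral_left) (auto simp: series_power_eq_0 assms)
  have "series_star f w = (\<Sum>n \<le> Suc (length w). series_power f n w)"
    by (rule star) simp
  also have "\<dots> = monomial [] w + (\<Sum>n \<le> length w. series_mult f (series_power f n) w)"
    by (simp only: sum.atMost_Suc_shift series_power.simps)
  also have "(\<Sum>n \<le> length w. series_mult f (series_power f n) w) =
      (\<Sum>(u, v) \<in> {(u, v). u @ v = w}. \<Sum>n \<le> length w. f u * series_power f n v)"
    unfolding series_mult_def by (subst sum.swap) (simp add: case_prod_unfold)
  also have "\<dots> = series_mult f (series_star f) w"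
    unfolding series_mult_def
    by (rule sum.cong) (auto simp: star[where N = "length w"] sum_distrib_left)
  finally show ?thesis .
qed

text \<open>Rational series: those built from the variables by finitely many algebra operations and stars
  of series without constant term.\<close>

inductive rational_series :: "'a series \<Rightarrow> bool" where
  one: "rational_series (monomial [])"
| var: "rational_series (monomial [x])"
| scale: "rational_series f \<Longrightarrow> rational_series (\<lambda>w. c * f w)"
| add: "rational_series f \<Longrightarrow> rational_series g \<Longrightarrow> rational_series (\<lambda>w. f w + g w)"
| mult: "rational_series f \<Longrightarrow> rational_series g \<Longrightarrow> rational_series (series_mult f g)"
| star: "rational_series f \<Longrightarrow> f [] = 0 \<Longrightarrow> rational_series (series_star f)"

definition generating_series :: "'a list set \<Rightarrow> 'a series" where
  "generating_series L = (\<lambda>w. if w \<in> L then 1 else 0)"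

definition regular_language :: "'a list set \<Rightarrow> bool" where
  "regular_language L \<longleftrightarrow> rational_series (generating_series L)"

end

theory Submission
  imports Defs
begin

text \<open>For \<open>i, j \<ge> 2\<close> the value \<open>\<mu>(a, a b\<^sup>i a b\<^sup>j a)\<close> is 1 if \<open>i = j\<close> and 0 otherwise: only borders of a
  word that do not occur in its interior contribute to \<open>\<mu>\<close>, and here the only candidate is
  \<open>a b\<^sup>j a\<close> with \<open>i = j\<close>. Hence the prefixes \<open>a b\<^sup>i\<close> have pairwise different left quotients.
  On the other hand, a rational series lies in a \<open>\<int>\<close>-module of series that is closed under left
  quotients and finite modulo 2, so modulo 2 it has only finitely many left quotients.\<close>

section \<open>The factor order\<close>

lemma sublist_snoc_iff: "sublist v (xs @ [y]) \<longleftrightarrow> suffix v (xs @ [y]) \<or> sublist v xs"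
  by (metis rev.simps(2) sublist_Cons_right sublist_rev_right suffix_to_prefix rev_swap)

text \<open>A proper factor must miss the first or the last letter, so deleting one of these letters
  yields the maximal proper factors.\<close>

lemma strict_sublist_Cons_snoc_iff:
  "strict_sublist v (x # m @ [y]) \<longleftrightarrow> sublist v (x # m) \<or> sublist v (m @ [y])"
proof
  assume "strict_sublist v (x # m @ [y])"
  then have "sublist v (x # m @ [y])" and ne: "v \<noteq> x # m @ [y]"
    by (auto simp: strict_sublist_def)
  then obtain ps ss where eq: "x # m @ [y] = ps @ v @ ss"
    by (auto simp: sublist_def)
  show "sublist v (x # m) \<or> sublist v (m @ [y])"
  proof (cases ps)
    case Nil
    with eq ne have "ss \<noteq> []" by auto
    then obtain ss' z where "ss = ss' @ [z]" by (metis rev_exhaust)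
    with eq Nil have "x # m = v @ ss'"
      by (metis append.assoc append_Cons append_Nil butlast_snoc)
    then show ?thesis by (auto simp: sublist_def intro: exI[of _ "[]"])
  next
    case (Cons p ps')
    with eq show ?thesis by (auto simp: sublist_def)
  qed
next
  assume a: "sublist v (x # m) \<or> sublist v (m @ [y])"
  then have "sublist v (x # m @ [y])"
    by (metis append_Cons sublist_Cons_right sublist_append)
  moreover have "length v < length (x # m @ [y])"
    using a by (auto dest: sublist_length_le)
  ultimately show "strict_sublist v (x # m @ [y])"
    by (auto simp: strict_sublist_def)
qed

text \<open>A common factor that avoids \<open>m\<close> must use the letter \<open>x\<close> in the
  first word and \<open>y\<close> in the second. It is then a proper border of
  \<open>x # m @ [y]\<close>.\<close>

lemma sublist_both_Cons_snoc_iff: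
  "sublist v (x # m) \<and> sublist v (m @ [y]) \<longleftrightarrow>
    sublist v m \<or> (prefix v (x # m) \<and> suffix v (m @ [y]))"
  by (metis prefix_imp_sublist sublist_Cons_right sublist_append sublist_snoc_iff suffix_imp_sublist)

text \<open>By inclusion-exclusion over the two maximal proper factors of \<open>w\<close>, only their common factors
  contribute; those inside the interior \<open>m\<close> cancel among themselves.\<close>

lemma factor_moebius_Cons_snoc:
  assumes "sublist u (x # m @ [y])" and len: "length u < length m"
  shows "factor_moebius u (x # m @ [y]) =
    (\<Sum>v \<in> {v. sublist u v \<and> prefix v (x # m) \<and> suffix v (m @ [y]) \<and> \<not> sublist v m}.
      factor_moebius u v)" (is "_ = sum _ ?B")
proof -
  let ?mu = "factor_moebius u"
  define F where "F w = {v. sublist u v \<and> sublist v w}" for w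
  have fin: "finite (F w)" for w
    unfolding F_def by (rule finite_subset[OF _ finite_factors[of w]]) auto
  \<comment> \<open>Used for \<open>x # m\<close>, \<open>m @ [y]\<close> and \<open>m\<close>: by
    \<open>len\<close> each is longer than \<open>u\<close>, hence different from it, so Moebius
    inversion gives 0.\<close>
  have zero: "sum ?mu (F w) = 0" if "length u < length w" for w
    unfolding F_def sum_factor_moebius using that by auto
  have "u \<noteq> x # m @ [y]" using len by auto
  then have "?mu (x # m @ [y]) = - sum ?mu {v. sublist u v \<and> strict_sublist v (x # m @ [y])}"
    using assms(1) factor_moebius.simps[of u "x # m @ [y]"] by simp
  also have "{v. sublist u v \<and> strict_sublist v (x # m @ [y])} = F (x # m) \<union> F (m @ [y])"
    unfolding F_def strict_sublist_Cons_snoc_iff by auto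
  also have "sum ?mu \<dots> = - sum ?mu (F (x # m) \<inter> F (m @ [y]))"
    using sum.union_inter[OF fin fin, of ?mu "x # m" "m @ [y]"] zero[of "x # m"] zero[of "m @ [y]"] len
    by simp
  also have "F (x # m) \<inter> F (m @ [y]) = F m \<union> ?B"
    using sublist_both_Cons_snoc_iff[of _ x m y] unfolding F_def by blast
  also have "sum ?mu (F m \<union> ?B) = sum ?mu (F m) + sum ?mu ?B"
  proof (rule sum.union_disjoint)
    show "finite ?B"
      by (rule finite_subset[OF _ fin[of "x # m"]]) (auto simp: F_def)
  qed (use fin in \<open>auto simp: F_def\<close>)
  finally show ?thesis using zero[OF len] by simp
qed

section \<open>The words \<open>a b\<^sup>i a b\<^sup>j a\<close>\<close>

text \<open>The letter \<open>x\<close> occurs only at the end of the word, so a suffix that begins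
  with \<open>x\<close> is that single letter.\<close>

lemma suffix_Cons_replicate_snoc:
  assumes "suffix (x # v) (replicate n y @ [x])" and "x \<noteq> y"
  shows "v = []"
proof (cases v rule: rev_cases)
  case (snoc v' z)
  with assms(1) have "suffix (x # v') (replicate n y)"
    by (metis append_Cons snoc_suffix_snoc)
  then have "x \<in> set (replicate n y)"
    by (meson list.set_intros(1) set_mono_suffix subsetD)
  with assms(2) show ?thesis by auto
qed

text \<open>The position of the first \<open>x\<close> can be read off from either side.\<close>

lemma replicate_append_Cons_eqD:
  assumes "replicate i y @ x # us = replicate j y @ x # vs" and "x \<noteq> y"
  shows "i = j"
  using assms
proof (induction i arbitrary: j)
  case 0
  then show ?case by (cases j) auto
next
  case (Suc i)
  then show ?case by (cases j) auto
qed

text \<open>The only border containing \<open>x\<close> is \<open>[x]\<close>, and it does not occur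
  in the interior. The bound \<open>2 \<le> n\<close> makes the interior longer than
  \<open>[x]\<close>.\<close>

lemma factor_moebius_one_block:
  assumes "x \<noteq> y" and "2 \<le> n"
  shows "factor_moebius [x] (x # replicate n y @ [x]) = 1"
proof -
  let ?m = "replicate n y"
  have "{v. sublist [x] v \<and> prefix v (x # ?m) \<and> suffix v (?m @ [x]) \<and> \<not> sublist v ?m} = {[x]}"
    (is "?B = _")
  proof (rule equalityI)
    show "?B \<subseteq> {[x]}"
    proof
      fix v assume v: "v \<in> ?B"
      then have "v \<noteq> []" by auto
      with v obtain v' where v': "v = x # v'" by (cases v) auto
      with v have "suffix (x # v') (?m @ [x])" by simp
      then have "v' = []" using assms(1) by (rule suffix_Cons_replicate_snoc)
      with v' show "v \<in> {[x]}" by simp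
    qed
    have "\<not> sublist [x] ?m"
      using assms(1) by (auto dest: set_mono_sublist)
    then show "{[x]} \<subseteq> ?B" by auto
  qed
  moreover have "factor_moebius [x] [x] = 1"
    by (simp add: factor_moebius.simps)
  moreover have "sublist [x] (x # ?m @ [x])"
    by (simp add: sublist_Cons_right)
  ultimately show ?thesis
    using factor_moebius_Cons_snoc[of "[x]" x ?m x] assms(2) by simp
qed

text \<open>The middle \<open>x\<close> excludes the border \<open>[x]\<close>. Any other suffix
  candidate beginning with \<open>x\<close> is the last block, which is a prefix exactly when both
  runs of \<open>y\<close> have equal length.\<close>

lemma factor_moebius_two_blocks:
  assumes "x \<noteq> y" and "2 \<le> i" and "2 \<le> j"
  shows "factor_moebius [x] (x # replicate i y @ x # replicate j y @ [x]) = (if i = j then 1 else 0)"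
proof -
  let ?m = "replicate i y @ x # replicate j y"
  let ?o = "x # replicate j y @ [x]"
  let ?B = "{v. sublist [x] v \<and> prefix v (x # ?m) \<and> suffix v (?m @ [x]) \<and> \<not> sublist v ?m}"
  have B: "v = ?o \<and> i = j" if "v \<in> ?B" for v
  proof -
    from that have "v \<noteq> []" by auto
    with that obtain v' where v': "v = x # v'" by (cases v) auto
    have "sublist [x] ?m" by (auto simp: sublist_def)
    with that v' have ne: "v' \<noteq> []" by auto
    have "suffix v (replicate i y @ ?o)" using that by simp
    \<comment> \<open>As \<open>v\<close> begins with \<open>x\<close> and is longer than
      \<open>[x]\<close>, it can start neither in the left run of \<open>y\<close> nor after the
      first letter of \<open>?o\<close>.\<close>
    then have "suffix v ?o \<or> (\<exists>zs. v = zs @ ?o \<and> suffix zs (replicate i y))"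
      by (simp only: suffix_append)
    then have o: "v = ?o"
    proof
      assume "suffix v ?o"
      then have "v = ?o \<or> suffix v (replicate j y @ [x])" by (simp only: suffix_Cons)
      then show ?thesis using v' ne assms(1) by (blast dest: suffix_Cons_replicate_snoc)
    next
      assume "\<exists>zs. v = zs @ ?o \<and> suffix zs (replicate i y)"
      then obtain zs where zs: "v = zs @ ?o" "suffix zs (replicate i y)" by blast
      show ?thesis
      proof (cases zs)
        case (Cons z zs')
        with zs v' have "x \<in> set (replicate i y)"
          by (metis append_Cons list.inject list.set_intros(1) set_mono_suffix subsetD)
        with assms(1) show ?thesis by auto
      qed (use zs in simp)
    qed
    moreover from that o obtain zs where "x # ?m = ?o @ zs" by (auto simp: prefix_def)
    then have "replicate i y @ x # replicate j y = replicate j y @ x # zs" by simp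
    then have "i = j" using assms(1) by (rule replicate_append_Cons_eqD)
    ultimately show ?thesis by simp
  qed
  have "?o \<in> ?B" if "i = j"
  proof -
    have "\<not> sublist ?o ?m"
    proof
      assume "sublist ?o ?m"
      then obtain ps ss where "?m = ps @ ?o @ ss" by (auto simp: sublist_def)
      \<comment> \<open>\<open>?m\<close> contains \<open>x\<close> once, \<open>?o\<close> contains
        it twice.\<close>
      then have "count_list ?m x = count_list (ps @ ?o @ ss) x" by simp
      then show False using assms(1) by simp
    qed
    moreover have "prefix ?o (x # ?m)" using that by (simp add: prefix_def)
    moreover have "suffix ?o (?m @ [x])" by (auto simp: suffix_def)
    ultimately show ?thesis by (simp add: sublist_Cons_right)
  qed
  with B have "?B = (if i = j then {?o} else {})" by auto
  moreover have "sublist [x] (x # ?m @ [x])"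
    by (simp add: sublist_Cons_right)
  ultimately have "factor_moebius [x] (x # ?m @ [x]) = (if i = j then factor_moebius [x] ?o else 0)"
    using factor_moebius_Cons_snoc[of "[x]" x ?m x] assms(2) by simp
  then show ?thesis using factor_moebius_one_block[OF assms(1,3)] by simp
qed

section \<open>Rational series modulo 2\<close>

text \<open>Product rule for the left quotient by \<open>x\<close>: in a factorization of
  \<open>x # w\<close> the first factor is empty or begins with \<open>x\<close>.\<close>

lemma series_mult_Cons:
  "series_mult f g (x # w) = f [] * g (x # w) + series_mult (\<lambda>v. f (x # v)) g w"
proof -
  let ?S = "{(u, v). u @ v = w}"
  have eq: "{(u, v). u @ v = x # w} = insert ([], x # w) ((\<lambda>(u, v). (x # u, v)) ` ?S)"
    by (auto simp: Cons_eq_append_conv append_eq_Cons_conv image_iff)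
  have "inj_on (\<lambda>(u, v). (x # u, v)) ?S" by (auto intro: inj_onI)
  then show ?thesis
    unfolding series_mult_def eq
    by (subst sum.insert)
      (auto simp: finite_splits[unfolded case_prod_unfold] sum.reindex case_prod_unfold)
qed

lemma series_mult_add_scale:
  "series_mult (\<lambda>v. f v + c * g v) h w = series_mult f h w + c * series_mult g h w"
  unfolding series_mult_def
  by (simp add: case_prod_unfold sum.distrib sum_distrib_left algebra_simps)

text \<open>Residues are represented by the integers 0 and 1, so a reduced series can again be fed
  to the operations on integer series.\<close>

definition series_mod2 :: "'a series \<Rightarrow> 'a series" where
  "series_mod2 f = (\<lambda>w. f w mod 2)"

text \<open>Reducing the first factor suffices: in the modules built from products below, the second
  factor is fixed.\<close>

lemma series_mult_mod2: "series_mult (series_mod2 f) g w mod 2 = series_mult f g w mod 2"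
proof -
  have "series_mult (series_mod2 f) g w mod 2
      = (\<Sum>(u, v) \<in> {(u, v). u @ v = w}. f u mod 2 * g v mod 2) mod 2"
    unfolding series_mult_def series_mod2_def
    by (subst mod_sum_eq[symmetric]) (simp add: case_prod_unfold)
  also have "\<dots> = series_mult f g w mod 2"
    unfolding series_mult_def
    by (subst (2) mod_sum_eq[symmetric]) (simp add: case_prod_unfold mod_mult_left_eq)
  finally show ?thesis .
qed

text \<open>The module itself may be infinite; only its reduction modulo 2 has to be finite.\<close>

definition stable_module :: "'a series set \<Rightarrow> bool" where
  "stable_module B \<longleftrightarrow>
    (\<forall>f\<in>B. \<forall>g\<in>B. \<forall>c. (\<lambda>w. f w + c * g w) \<in> B) \<and>
    (\<forall>f\<in>B. \<forall>x. (\<lambda>w. f (x # w)) \<in> B) \<and>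
    finite (series_mod2 ` B)"

lemma stable_moduleI:
  assumes "\<And>f g c. f \<in> B \<Longrightarrow> g \<in> B \<Longrightarrow> (\<lambda>w. f w + c * g w) \<in> B"
    and "\<And>f x. f \<in> B \<Longrightarrow> (\<lambda>w. f (x # w)) \<in> B"
    and "finite (series_mod2 ` B)"
  shows "stable_module B"
  using assms by (auto simp: stable_module_def)

lemma stable_moduleD:
  assumes "stable_module B"
  shows "f \<in> B \<Longrightarrow> g \<in> B \<Longrightarrow> (\<lambda>w. f w + c * g w) \<in> B"
    and "f \<in> B \<Longrightarrow> (\<lambda>w. f (x # w)) \<in> B"
    and "finite (series_mod2 ` B)"
  using assms by (auto simp: stable_module_def)

lemma stable_module_zero:
  assumes "stable_module B" and "f \<in> B"
  shows "(\<lambda>w. 0) \<in> B"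
  using stable_moduleD(1)[OF assms(1) assms(2) assms(2), of "-1"] by simp

lemma stable_module_scale:
  assumes "stable_module B" and "f \<in> B"
  shows "(\<lambda>w. c * f w) \<in> B"
  using stable_moduleD(1)[OF assms(1) stable_module_zero[OF assms] assms(2), of c] by simp

section \<open>Constructions of stable modules: sum, adjunction, product, star\<close>

lemma mem_Collect_image2I:
  assumes "p = h f g" and "f \<in> A" and "g \<in> B"
  shows "p \<in> {h f g | f g. f \<in> A \<and> g \<in> B}"
  using assms by blast

text \<open>The residue of \<open>h f g\<close> depends only on the residues of \<open>f\<close> and
  \<open>g\<close>, which leaves finitely many pairs.\<close>

lemma finite_series_mod2_image2:
  assumes "finite (series_mod2 ` A)" and "finite (series_mod2 ` B)"
    and "\<And>f g. f \<in> A \<Longrightarrow> g \<in> B \<Longrightarrow>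
      series_mod2 (h f g) = series_mod2 (h (series_mod2 f) (series_mod2 g))"
  shows "finite (series_mod2 ` {h f g | f g. f \<in> A \<and> g \<in> B})"
proof (rule finite_subset)
  show "series_mod2 ` {h f g | f g. f \<in> A \<and> g \<in> B}
      \<subseteq> (\<lambda>(p, q). series_mod2 (h p q)) ` (series_mod2 ` A \<times> series_mod2 ` B)"
    using assms(3) by force
  show "finite ((\<lambda>(p, q). series_mod2 (h p q)) ` (series_mod2 ` A \<times> series_mod2 ` B))"
    using assms(1,2) by blast
qed

lemma stable_module_sum:
  assumes A: "stable_module A" and B: "stable_module B"
  shows "stable_module {\<lambda>w. f w + g w | f g. f \<in> A \<and> g \<in> B}" (is "stable_module ?C")
proof (rule stable_moduleI)
  fix p q c assume "p \<in> ?C" "q \<in> ?C"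
  then obtain f g f' g' where eq: "p = (\<lambda>w. f w + g w)" "q = (\<lambda>w. f' w + g' w)"
    and mem: "f \<in> A" "g \<in> B" "f' \<in> A" "g' \<in> B" by auto
  have "(\<lambda>w. p w + c * q w) = (\<lambda>w. (f w + c * f' w) + (g w + c * g' w))"
    by (simp add: eq algebra_simps)
  then show "(\<lambda>w. p w + c * q w) \<in> ?C"
    by (rule mem_Collect_image2I[where h = "\<lambda>f g w. f w + g w"])
      (rule stable_moduleD(1)[OF A mem(1,3)] stable_moduleD(1)[OF B mem(2,4)])+
next
  fix p x assume "p \<in> ?C"
  then obtain f g where p: "p = (\<lambda>w. f w + g w)" and mem: "f \<in> A" "g \<in> B" by auto
  then have "(\<lambda>w. p (x # w)) = (\<lambda>w. f (x # w) + g (x # w))" by simp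
  then show "(\<lambda>w. p (x # w)) \<in> ?C"
    by (rule mem_Collect_image2I[where h = "\<lambda>f g w. f w + g w"])
      (rule stable_moduleD(2)[OF A mem(1)] stable_moduleD(2)[OF B mem(2)])+
next
  show "finite (series_mod2 ` ?C)"
    using stable_moduleD(3)[OF A] stable_moduleD(3)[OF B]
    by (rule finite_series_mod2_image2) (simp add: series_mod2_def mod_simps)
qed

text \<open>Left quotients of \<open>f\<close> fall back into \<open>B\<close>, so the multiples of
  \<open>f\<close> are the only new elements; modulo 2 only the parity of \<open>c\<close>
  matters.\<close>

lemma stable_module_adjoin:
  assumes B: "stable_module B" and shift: "\<And>x. (\<lambda>w. f (x # w)) \<in> B"
  shows "stable_module {\<lambda>w. c * f w + g w | c g. g \<in> B}" (is "stable_module ?C")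
proof (rule stable_moduleI)
  fix p q c assume "p \<in> ?C" "q \<in> ?C"
  then obtain d g d' g' where eq: "p = (\<lambda>w. d * f w + g w)" "q = (\<lambda>w. d' * f w + g' w)"
    and mem: "g \<in> B" "g' \<in> B" by auto
  have "(\<lambda>w. p w + c * q w) = (\<lambda>w. (d + c * d') * f w + (g w + c * g' w))"
    by (simp add: eq algebra_simps)
  then show "(\<lambda>w. p w + c * q w) \<in> ?C"
    using stable_moduleD(1)[OF B mem, of c] by (intro CollectI exI conjI)
next
  fix p x assume "p \<in> ?C"
  then obtain c g where p: "p = (\<lambda>w. c * f w + g w)" and g: "g \<in> B" by auto
  have "(\<lambda>w. g (x # w) + c * f (x # w)) \<in> B"
    by (rule stable_moduleD(1)[OF B stable_moduleD(2)[OF B g] shift])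
  \<comment> \<open>The quotient already lies in \<open>B\<close>, hence the coefficient 0 at
    \<open>f\<close>.\<close>
  moreover have "(\<lambda>w. p (x # w)) = (\<lambda>w. 0 * f w + (g (x # w) + c * f (x # w)))"
    by (simp add: p add.commute)
  ultimately show "(\<lambda>w. p (x # w)) \<in> ?C" by (intro CollectI exI conjI)
next
  let ?h = "\<lambda>(d, q). series_mod2 (\<lambda>w. d * f w + q w)"
  have "series_mod2 ` ?C \<subseteq> ?h ` ({0, 1} \<times> series_mod2 ` B)"
  proof
    fix p assume "p \<in> series_mod2 ` ?C"
    then obtain c g where p: "p = series_mod2 (\<lambda>w. c * f w + g w)" and g: "g \<in> B" by auto
    have "p = ?h (c mod 2, series_mod2 g)"
      by (auto simp: p series_mod2_def fun_eq_iff intro!: mod_add_cong mod_mult_cong)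
    moreover have "c mod 2 \<in> {0, 1}" by auto
    ultimately show "p \<in> ?h ` ({0, 1} \<times> series_mod2 ` B)"
      using g by (intro image_eqI[where x = "(c mod 2, series_mod2 g)"] SigmaI imageI)
  qed
  then show "finite (series_mod2 ` ?C)"
    by (rule finite_subset) (simp add: stable_moduleD(3)[OF B])
qed

text \<open>Reduces membership of \<open>f\<close> to its one-letter quotients. The element
  \<open>g\<close> ensures that \<open>B\<close> is nonempty and thus contains 0.\<close>

lemma stable_module_of_shifts:
  assumes B: "stable_module B" "g \<in> B" and shift: "\<And>x. (\<lambda>w. f (x # w)) \<in> B"
  shows "\<exists>C. stable_module C \<and> f \<in> C"
proof (intro exI conjI)
  show "stable_module {\<lambda>w. c * f w + g w | c g. g \<in> B}"
    by (rule stable_module_adjoin[OF B(1) shift])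
  have "f = (\<lambda>w. 1 * f w + 0)" by simp
  then show "f \<in> {\<lambda>w. c * f w + g w | c g. g \<in> B}"
    using stable_module_zero[OF B] by (intro CollectI exI[of _ 1] exI[of _ "\<lambda>w. 0"] conjI)
qed

lemma stable_module_trivial: "stable_module {\<lambda>w. 0}"
  by (rule stable_moduleI) auto

text \<open>A one-letter quotient of a monomial is 0 or the monomial of a shorter word.\<close>

lemma stable_module_monomial: "\<exists>B. stable_module B \<and> monomial u \<in> B"
proof (induction u)
  case Nil
  have "(\<lambda>w. monomial [] (x # w)) \<in> {\<lambda>w. 0}" for x :: 'a
    by (simp add: monomial_def)
  then show ?case
    by (rule stable_module_of_shifts[OF stable_module_trivial singletonI])
next
  case (Cons x u)
  then obtain B where B: "stable_module B" "monomial u \<in> B" by blast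
  have "(\<lambda>w. monomial (x # u) (y # w)) \<in> B" for y
  proof (cases "y = x")
    case True
    then have "(\<lambda>w. monomial (x # u) (y # w)) = monomial u" by (auto simp: monomial_def)
    with B(2) show ?thesis by simp
  next
    case False
    then have "(\<lambda>w. monomial (x # u) (y # w)) = (\<lambda>w. 0)" by (auto simp: monomial_def)
    with stable_module_zero[OF B] show ?thesis by simp
  qed
  then show ?case by (rule stable_module_of_shifts[OF B])
qed

text \<open>The module is \<open>A g + B\<close>. By the product rule, a quotient of
  \<open>p g\<close> is a quotient of \<open>p\<close> times \<open>g\<close>, plus a multiple of a
  quotient of \<open>g\<close>, which \<open>B\<close> absorbs.\<close>

lemma stable_module_mult:
  assumes A: "stable_module A" "f \<in> A" and B: "stable_module B" "g \<in> B"
  shows "\<exists>C. stable_module C \<and> series_mult f g \<in> C"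
proof -
  let ?C = "{\<lambda>w. series_mult p g w + q w | p q. p \<in> A \<and> q \<in> B}"
  have "stable_module ?C"
  proof (rule stable_moduleI)
    fix r s c assume "r \<in> ?C" "s \<in> ?C"
    then obtain p q p' q' where eq: "r = (\<lambda>w. series_mult p g w + q w)"
        "s = (\<lambda>w. series_mult p' g w + q' w)"
      and mem: "p \<in> A" "q \<in> B" "p' \<in> A" "q' \<in> B" by auto
    have "(\<lambda>w. r w + c * s w) =
        (\<lambda>w. series_mult (\<lambda>v. p v + c * p' v) g w + (q w + c * q' w))"
      by (simp add: eq series_mult_add_scale algebra_simps)
    then show "(\<lambda>w. r w + c * s w) \<in> ?C"
      by (rule mem_Collect_image2I[where h = "\<lambda>p q w. series_mult p g w + q w"])
        (rule stable_moduleD(1)[OF A(1) mem(1,3)] stable_moduleD(1)[OF B(1) mem(2,4)])+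
  next
    fix r x assume "r \<in> ?C"
    then obtain p q where r: "r = (\<lambda>w. series_mult p g w + q w)" and mem: "p \<in> A" "q \<in> B" by auto
    have "(\<lambda>w. r (x # w)) =
        (\<lambda>w. series_mult (\<lambda>v. p (x # v)) g w + (q (x # w) + p [] * g (x # w)))"
      by (simp add: r series_mult_Cons algebra_simps)
    moreover have "(\<lambda>w. q (x # w) + p [] * g (x # w)) \<in> B"
      using stable_moduleD(1,2)[OF B(1)] mem B(2) by blast
    ultimately show "(\<lambda>w. r (x # w)) \<in> ?C"
      using stable_moduleD(2)[OF A(1) mem(1), of x] by (intro CollectI exI conjI)
  next
    have "(series_mult p g w + q w) mod 2 =
        (series_mult (series_mod2 p) g w + series_mod2 q w) mod 2" for p q w
      by (subst mod_add_eq[symmetric], subst series_mult_mod2[symmetric])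
        (simp add: series_mod2_def mod_simps)
    then have "series_mod2 (\<lambda>w. series_mult p g w + q w) =
        series_mod2 (\<lambda>w. series_mult (series_mod2 p) g w + series_mod2 q w)" for p q
      unfolding series_mod2_def[of "\<lambda>w. _ w + _ w"] by simp
    with stable_moduleD(3)[OF A(1)] stable_moduleD(3)[OF B(1)]
    show "finite (series_mod2 ` ?C)"
      by (rule finite_series_mod2_image2)
  qed
  moreover have "series_mult f g \<in> ?C"
    using A(2) stable_module_zero[OF B]
    by (intro CollectI exI[of _ f] exI[of _ "\<lambda>w. 0"] conjI) simp_all
  ultimately show ?thesis by blast
qed

text \<open>The multiples of \<open>?s\<close> by elements of \<open>B\<close> form a stable module
  \<open>?D\<close> that contains every one-letter quotient of \<open>?s\<close>; adjoining
  \<open>?s\<close> itself completes the construction.\<close>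

lemma stable_module_star:
  assumes B: "stable_module B" "f \<in> B" and f0: "f [] = 0"
  shows "\<exists>C. stable_module C \<and> series_star f \<in> C"
proof -
  let ?s = "series_star f"
  \<comment> \<open>In \<open>?s = 1 + f ?s\<close> the term 1 has no coefficient at
    \<open>x # w\<close>, and \<open>f0\<close> removes the first summand of the product
    rule.\<close>
  have shift_star: "?s (x # w) = series_mult (\<lambda>v. f (x # v)) ?s w" for x w
    by (subst series_star_unfold[where f = f, OF f0]) (simp add: monomial_def series_mult_Cons f0)
  let ?D = "{series_mult p ?s | p. p \<in> B}"
  have "stable_module ?D"
  proof (rule stable_moduleI)
    fix r q c assume "r \<in> ?D" "q \<in> ?D"
    then obtain p p' where eq: "r = series_mult p ?s" "q = series_mult p' ?s"
      and mem: "p \<in> B" "p' \<in> B" by auto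
    have "(\<lambda>w. r w + c * q w) = series_mult (\<lambda>v. p v + c * p' v) ?s"
      by (simp add: eq series_mult_add_scale fun_eq_iff)
    then show "(\<lambda>w. r w + c * q w) \<in> ?D"
      using stable_moduleD(1)[OF B(1) mem, of c] by blast
  next
    fix r x assume "r \<in> ?D"
    then obtain p where r: "r = series_mult p ?s" and p: "p \<in> B" by auto
    have "(\<lambda>w. r (x # w)) = series_mult (\<lambda>v. p (x # v) + p [] * f (x # v)) ?s"
      by (simp add: r series_mult_Cons series_mult_add_scale shift_star fun_eq_iff)
    moreover have "(\<lambda>v. p (x # v) + p [] * f (x # v)) \<in> B"
      using stable_moduleD(1,2)[OF B(1)] p B(2) by blast
    ultimately show "(\<lambda>w. r (x # w)) \<in> ?D" by blast
  next
    have "series_mod2 ` ?D \<subseteq> (\<lambda>p. series_mod2 (series_mult p ?s)) ` (series_mod2 ` B)"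
      by (auto simp: series_mod2_def[of "series_mult _ _"] series_mult_mod2 image_iff)
    then show "finite (series_mod2 ` ?D)"
      using stable_moduleD(3)[OF B(1)] by (meson finite_imageI finite_subset)
  qed
  moreover have "(\<lambda>w. ?s (x # w)) \<in> ?D" for x
    using stable_moduleD(2)[OF B, of x] by (auto simp: shift_star)
  \<comment> \<open>Witness that \<open>?D\<close> is nonempty.\<close>
  moreover have "series_mult f ?s \<in> ?D" using B(2) by blast
  ultimately show ?thesis by (intro stable_module_of_shifts[of ?D])
qed

lemma rational_series_stable_module:
  assumes "rational_series f"
  shows "\<exists>B. stable_module B \<and> f \<in> B"
  using assms
proof (induction rule: rational_series.induct)
  case (scale f c)
  then obtain B where "stable_module B" "f \<in> B" by blast
  then have "stable_module B \<and> (\<lambda>w. c * f w) \<in> B"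
    by (auto intro: stable_module_scale)
  then show ?case by (rule exI)
next
  case (add f g)
  then obtain A B where A: "stable_module A" "f \<in> A" and B: "stable_module B" "g \<in> B" by blast
  have "(\<lambda>w. f w + g w) \<in> {\<lambda>w. f w + g w | f g. f \<in> A \<and> g \<in> B}"
    by (rule mem_Collect_image2I[where h = "\<lambda>f g w. f w + g w", OF refl A(2) B(2)])
  with stable_module_sum[OF A(1) B(1)] show ?case by (intro exI conjI)
next
  case (mult f g)
  then show ?case using stable_module_mult by blast
next
  case (star f)
  then show ?case using stable_module_star by blast
qed (rule stable_module_monomial)+

text \<open>One direction of a Myhill-Nerode argument modulo 2: iterating one-letter quotients never
  leaves \<open>B\<close>.\<close>

lemma rational_series_finite_shifts_mod2:
  assumes "rational_series f"
  shows "finite (range (\<lambda>u. series_mod2 (\<lambda>w. f (u @ w))))"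
proof -
  obtain B where B: "stable_module B" "f \<in> B"
    using rational_series_stable_module[OF assms] by blast
  have "(\<lambda>w. g (u @ w)) \<in> B" if "g \<in> B" for u g
    using that
  proof (induction u arbitrary: g)
    case (Cons x u)
    from Cons.IH[OF stable_moduleD(2)[OF B(1) Cons.prems, of x]] show ?case by simp
  qed simp
  with B(2) have "range (\<lambda>u. series_mod2 (\<lambda>w. f (u @ w))) \<subseteq> series_mod2 ` B" by blast
  then show ?thesis using stable_moduleD(3)[OF B(1)] by (rule finite_subset)
qed

theorem theorem7p3:
  "\<not> regular_language {w :: letter list. factor_moebius [Letter_a] w \<noteq> 0}"
proof
  define f where "f = generating_series {w :: letter list. factor_moebius [Letter_a] w \<noteq> 0}"
  \<comment> \<open>The offset 2 meets the bounds of \<open>factor_moebius_two_blocks\<close> for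
    all natural indices.\<close>
  define u where "u i = Letter_a # replicate (i + 2) Letter_b" for i
  define v where "v j = Letter_a # replicate (j + 2) Letter_b @ [Letter_a]" for j
  have f_uv: "f (u i @ v j) = (if i = j then 1 else 0)" for i j
    using factor_moebius_two_blocks[of Letter_a Letter_b "i + 2" "j + 2"]
    by (simp add: f_def generating_series_def u_def v_def)
  assume "regular_language {w :: letter list. factor_moebius [Letter_a] w \<noteq> 0}"
  then have "finite (range (\<lambda>p. series_mod2 (\<lambda>w. f (p @ w))))"
    unfolding regular_language_def f_def by (rule rational_series_finite_shifts_mod2)
  then have "finite (range (\<lambda>i. series_mod2 (\<lambda>w. f (u i @ w))))"
    by (rule rev_finite_subset) blast
  moreover have "inj (\<lambda>i. series_mod2 (\<lambda>w. f (u i @ w)))"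
  proof (rule injI)
    fix i j assume "series_mod2 (\<lambda>w. f (u i @ w)) = series_mod2 (\<lambda>w. f (u j @ w))"
    \<comment> \<open>The word \<open>v i\<close> separates the quotients: the left side is 1, the
      right side is 1 only for \<open>i = j\<close>.\<close>
    then have "f (u i @ v i) mod 2 = f (u j @ v i) mod 2"
      by (auto simp: series_mod2_def dest: fun_cong)
    then show "i = j" by (simp add: f_uv split: if_splits)
  qed
  ultimately show False
    using finite_imageD infinite_UNIV_nat by blast
qed

end
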